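(* Let $s\in\mathbb C$ and let $w=y^s\,dx$, a (complex-valued) $1$-form on the hyperbolic upper half-plane $\mathbb H$. Then $$\triangle^1w=-s(s+1)\,w.$$
   Context: $\mathbb H=\{(x,y):y>0\}$ is equipped with the hyperbolic Riemannian metric $(dx^2+dy^2)/y^2$. $\triangle^1$ is the Hodge Laplacian on $1$-forms on $\mathbb H$ (extended complex-linearly), with the sign convention that it is a nonnegative operator ($\triangle^1=d\delta+\delta d$, equivalently $\triangle^1w=\nabla^*\nabla w+\mathrm{Ric}(w^\#,\cdot)$ with $\nabla^*\nabla$ the Bochner Laplacian). *)

theory Defs
  imports "HOL-Analysis.Analysis"
begin

text \<open>
  Complex-valued differential forms on (an open subset of) the plane, in the global chart \<open>(x, y)\<close>.
  Tangent vectors \<open>u\<close> at any point are identified with their components \<open>(dx u, dy u)\<close>. A 1-form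
  is pointwise a real-linear map, a 2-form an alternating real-bilinear one; these pointwise
  conditions are not part of the types. All operators below are local, so on an open set
  values of forms outside of it are irrelevant.
\<close>

type_synonym plane = "real \<times> real"
type_synonym form0 = "plane \<Rightarrow> complex"
type_synonym form1 = "plane \<Rightarrow> plane \<Rightarrow> complex"
type_synonym form2 = "plane \<Rightarrow> plane \<Rightarrow> plane \<Rightarrow> complex"
type_synonym metric2 = "plane \<Rightarrow> plane \<Rightarrow> plane \<Rightarrow> real"

abbreviation e1 :: plane where "e1 \<equiv> (1, 0)"
abbreviation e2 :: plane where "e2 \<equiv> (0, 1)"

definition dx :: form1 where
  "dx p v = of_real (fst v)"

definition ext_d0 :: "form0 \<Rightarrow> form1" where
  "ext_d0 f p v = frechet_derivative f (at p) v"

text \<open>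
  \<open>dw(u,v) = u(w(v)) - v(w(u)) - w([u,v])\<close> for constant, hence commuting, vector fields \<open>u\<close>, \<open>v\<close>.
\<close>

definition ext_d1 :: "form1 \<Rightarrow> form2" where
  "ext_d1 w p u v =
     frechet_derivative (\<lambda>q. w q v) (at p) u - frechet_derivative (\<lambda>q. w q u) (at p) v"

definition gram_det :: "metric2 \<Rightarrow> plane \<Rightarrow> real" where
  "gram_det g p = g p e1 e1 * g p e2 e2 - g p e1 e2 * g p e2 e1"

text \<open>The volume form for the standard orientation, in which \<open>dx \<and> dy\<close> is positive.\<close>

definition vol_form :: "metric2 \<Rightarrow> form2" where
  "vol_form g p u v = of_real (sqrt (gram_det g p) * (fst u * snd v - snd u * fst v))"

text \<open>
  Components \<open>g\<^sup>i\<^sup>j w\<^sub>j\<close> of the (complex) vector field \<open>w\<^sup>#\<close>, with the inverse of the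
  2-by-2 Gram matrix written out.
\<close>

definition sharp1 :: "metric2 \<Rightarrow> form1 \<Rightarrow> plane \<Rightarrow> complex" where
  "sharp1 g w p =
     (of_real (g p e2 e2) * w p e1 - of_real (g p e1 e2) * w p e2) / of_real (gram_det g p)"

definition sharp2 :: "metric2 \<Rightarrow> form1 \<Rightarrow> plane \<Rightarrow> complex" where
  "sharp2 g w p =
     (of_real (g p e1 e1) * w p e2 - of_real (g p e2 e1) * w p e1) / of_real (gram_det g p)"

text \<open>
  The pairing \<open>g\<^sup>i\<^sup>j a\<^sub>i b\<^sub>j\<close> of 1-forms, extended complex-bilinearly.
\<close>

definition form1_inner :: "metric2 \<Rightarrow> form1 \<Rightarrow> form1 \<Rightarrow> form0" where
  "form1_inner g a b p = a p e1 * sharp1 g b p + a p e2 * sharp2 g b p"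

text \<open>
  The Hodge star on 1-forms is \<open>\<star>w = vol(w\<^sup>#, -)\<close>; on 2-forms it is the inverse of \<open>f \<mapsto> f vol\<close>.
\<close>

definition hodge_star1 :: "metric2 \<Rightarrow> form1 \<Rightarrow> form1" where
  "hodge_star1 g w p v = sharp1 g w p * vol_form g p e1 v + sharp2 g w p * vol_form g p e2 v"

definition hodge_star2 :: "metric2 \<Rightarrow> form2 \<Rightarrow> form0" where
  "hodge_star2 g \<omega> p = \<omega> p e1 e2 / vol_form g p e1 e2"

text \<open>The defining property \<open>a \<and> \<star>b = \<langle>a, b\<rangle> vol\<close>, which fixes the sign of the star.\<close>

lemma hodge_star1_wedge:
  assumes "linear (a p)"
  shows "a p u * hodge_star1 g b p v - a p v * hodge_star1 g b p u =
           form1_inner g a b p * vol_form g p u v"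
proof -
  have lin: "a p z = of_real (fst z) * a p e1 + of_real (snd z) * a p e2" for z
  proof -
    have "z = fst z *\<^sub>R e1 + snd z *\<^sub>R e2"
      by (simp add: prod_eq_iff)
    then have "a p z = a p (fst z *\<^sub>R e1 + snd z *\<^sub>R e2)"
      by simp
    also have "\<dots> = fst z *\<^sub>R a p e1 + snd z *\<^sub>R a p e2"
      by (simp only: linear_add[OF assms] linear_scale[OF assms])
    finally show ?thesis
      by (simp add: scaleR_conv_of_real)
  qed
  show ?thesis
    unfolding form1_inner_def hodge_star1_def vol_form_def lin[of u] lin[of v]
    by (simp add: algebra_simps)
qed

text \<open>
  The codifferential \<open>\<delta> = (-1)\<^bsup>n(k+1)+1\<^esup> \<star>d\<star>\<close> on \<open>k\<close>-forms, i.e. \<open>-\<star>d\<star>\<close> in dimension \<open>n = 2\<close>.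
\<close>

definition codiff1 :: "metric2 \<Rightarrow> form1 \<Rightarrow> form0" where
  "codiff1 g w p = - hodge_star2 g (ext_d1 (hodge_star1 g w)) p"

definition codiff2 :: "metric2 \<Rightarrow> form2 \<Rightarrow> form1" where
  "codiff2 g \<omega> p v = - hodge_star1 g (ext_d0 (hodge_star2 g \<omega>)) p v"

definition hodge_laplacian1 :: "metric2 \<Rightarrow> form1 \<Rightarrow> form1" where
  "hodge_laplacian1 g w p v = ext_d0 (codiff1 g w) p v + codiff2 g (ext_d1 w) p v"

definition upper_half_plane :: "plane set" where
  "upper_half_plane = {(x, y). y > 0}"

definition hyperbolic_metric :: metric2 where
  "hyperbolic_metric p u v = (fst u * fst v + snd u * snd v) / (snd p)\<^sup>2"

end

theory Submission imports Defs begin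

text \<open>
  The hyperbolic metric is conformal to the Euclidean one and the plane has dimension two, so the
  Hodge star on 1-forms is the Euclidean one (\<open>dx \<mapsto> dy\<close>, \<open>dy \<mapsto> -dx\<close>), while on 2-forms the area
  density \<open>y\<^sup>-\<^sup>2\<close> contributes a factor \<open>y\<^sup>2\<close>. Hence \<open>\<star>w = y\<^sup>s dy\<close> is closed and \<open>\<delta>w = 0\<close>: only \<open>\<delta>d\<close>
  survives in the Laplacian. There \<open>dw = - s y\<^bsup>s-1\<^esup> dx \<and> dy\<close>, so \<open>\<star>dw = - s y\<^bsup>s+1\<^esup>\<close>, whose
  differential is \<open>- s (s + 1) y\<^sup>s dy\<close>; the outer \<open>-\<star>\<close> turns \<open>dy\<close> back into \<open>dx\<close>. The exponent returns to
  \<open>s\<close> because the two derivatives lower it by two and the star on 2-forms raises it by two.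

  Derivatives are taken at points of the half-plane only, an open set on which each coefficient is a
  constant multiple of a power of \<open>y\<close>; the lemma \<open>frechet_derivative_height_powr\<close> covers all
  these derivatives.
\<close>

lemma upper_half_plane_iff: "p \<in> upper_half_plane \<longleftrightarrow> 0 < snd p"
  by (auto simp: upper_half_plane_def split: prod.splits)

lemma open_upper_half_plane: "open upper_half_plane"
proof -
  have "upper_half_plane = {p. 0 < snd p}"
    using upper_half_plane_iff by blast
  moreover have "open {p::plane. 0 < snd p}"
    by (intro open_Collect_less continuous_intros)
  ultimately show ?thesis
    by simp
qed

text \<open>
  The hypothesis constrains \<open>f\<close> on the half-plane alone; openness makes this enough to
  determine its derivative there.
\<close>

lemma frechet_derivative_height_powr:
  fixes f :: form0
  assumes f: "\<And>q. q \<in> upper_half_plane \<Longrightarrow> f q = c * of_real (snd q) powr a"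
    and p: "p \<in> upper_half_plane"
  shows "frechet_derivative f (at p) h = c * (a * of_real (snd p) powr (a - 1)) * of_real (snd h)"
proof -
  have "complex_of_real (snd p) \<notin> \<real>\<^sub>\<le>\<^sub>0"
    using p by (simp add: upper_half_plane_iff)
  then have outer: "((\<lambda>z. z powr a) has_field_derivative a * of_real (snd p) powr (a - 1))
               (at (complex_of_real (snd p)))"
    by (rule has_field_derivative_powr)
  have inner: "((\<lambda>q::plane. complex_of_real (snd q)) has_derivative (\<lambda>h. of_real (snd h))) (at p)"
    by (intro derivative_eq_intros | simp)+
  have "((\<lambda>q::plane. complex_of_real (snd q) powr a) has_derivative
          (\<lambda>h. a * of_real (snd p) powr (a - 1) * of_real (snd h))) (at p)"
    using has_derivative_compose[OF inner outer[unfolded has_field_derivative_def]] .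
  then have "((\<lambda>q. c * of_real (snd q) powr a) has_derivative
          (\<lambda>h. c * (a * of_real (snd p) powr (a - 1) * of_real (snd h)))) (at p)"
    by (rule has_derivative_mult_right)
  then have "(f has_derivative
          (\<lambda>h. c * (a * of_real (snd p) powr (a - 1) * of_real (snd h)))) (at p)"
    by (rule has_derivative_transform_within_open[OF _ open_upper_half_plane p]) (simp add: f)
  from frechet_derivative_at[OF this] show ?thesis
    by (metis mult.assoc)
qed

lemma gram_det_hyperbolic: "gram_det hyperbolic_metric p = 1 / snd p ^ 4"
  by (simp add: gram_det_def hyperbolic_metric_def flip: power_add)

lemma sqrt_gram_det_hyperbolic: "sqrt (gram_det hyperbolic_metric p) = 1 / (snd p)\<^sup>2"
proof -
  have "gram_det hyperbolic_metric p = (1 / (snd p)\<^sup>2)\<^sup>2"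
    by (simp add: gram_det_hyperbolic power_divide flip: power_mult)
  then show ?thesis
    by simp
qed

text \<open>
  Conformal invariance of the star in the middle degree: raising the index gives a factor \<open>y\<^sup>2\<close>,
  which cancels the area density \<open>y\<^sup>-\<^sup>2\<close>.
\<close>

lemma hodge_star1_hyperbolic:
  assumes "p \<in> upper_half_plane"
  shows "hodge_star1 hyperbolic_metric a p v = a p e1 * of_real (snd v) - a p e2 * of_real (fst v)"
proof -
  have y: "snd p \<noteq> 0"
    using assms by (simp add: upper_half_plane_iff)
  have "sharp1 hyperbolic_metric a p = of_real (snd p)^2 * a p e1"
       "sharp2 hyperbolic_metric a p = of_real (snd p)^2 * a p e2"
    using y unfolding sharp1_def sharp2_def gram_det_hyperbolic
    by (simp_all add: hyperbolic_metric_def field_simps power_numeral_reduce)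
  then show ?thesis
    using y unfolding hodge_star1_def vol_form_def sqrt_gram_det_hyperbolic
    by (simp add: field_simps)
qed

lemma hodge_star2_hyperbolic:
  "hodge_star2 hyperbolic_metric \<omega> p = of_real (snd p)^2 * \<omega> p e1 e2"
  unfolding hodge_star2_def vol_form_def sqrt_gram_det_hyperbolic
  by simp

text \<open>The form \<open>\<star>w = y\<^sup>s dy\<close> is closed, its coefficient being independent of \<open>x\<close>.\<close>

lemma codiff1_height_powr_dx:
  assumes w: "\<And>p v. p \<in> upper_half_plane \<Longrightarrow> w p v = (of_real (snd p) powr s) * dx p v"
    and p: "p \<in> upper_half_plane"
  shows "codiff1 hyperbolic_metric w p = 0"
proof -
  have star: "hodge_star1 hyperbolic_metric w q v = of_real (snd v) * of_real (snd q) powr s"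
    if "q \<in> upper_half_plane" for q v
    using that by (simp add: hodge_star1_hyperbolic w dx_def)
  have "ext_d1 (hodge_star1 hyperbolic_metric w) p e1 e2 = 0"
    unfolding ext_d1_def
    by (simp add: frechet_derivative_height_powr[OF star p])
  then show ?thesis
    by (simp add: codiff1_def hodge_star2_hyperbolic)
qed

text \<open>
  Differentiation gives the power \<open>s - 1\<close> with a minus sign from \<open>dy \<and> dx = - dx \<and> dy\<close>, and
  dividing by the area density \<open>y\<^sup>-\<^sup>2\<close> raises the power to \<open>s + 1\<close>.
\<close>

lemma hodge_star2_ext_d1_height_powr_dx:
  assumes w: "\<And>p v. p \<in> upper_half_plane \<Longrightarrow> w p v = (of_real (snd p) powr s) * dx p v"
    and p: "p \<in> upper_half_plane"
  shows "hodge_star2 hyperbolic_metric (ext_d1 w) p = - s * of_real (snd p) powr (s + 1)"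
proof -
  have w': "w q v = of_real (fst v) * of_real (snd q) powr s" if "q \<in> upper_half_plane" for q v
    using that by (simp add: w dx_def)
  have "ext_d1 w p e1 e2 = - s * of_real (snd p) powr (s - 1)"
    unfolding ext_d1_def
    by (simp add: frechet_derivative_height_powr[OF w' p])
  moreover have "complex_of_real (snd p) powr (s + 1) = of_real (snd p)^2 * of_real (snd p) powr (s - 1)"
  proof -
    have y: "complex_of_real (snd p) \<noteq> 0"
      using p by (simp add: upper_half_plane_iff)
    have "complex_of_real (snd p) powr (s + 1) = of_real (snd p) powr (2 + (s - 1))"
      by (simp add: algebra_simps)
    also have "\<dots> = of_real (snd p) powr 2 * of_real (snd p) powr (s - 1)"
      by (rule powr_add)
    also have "complex_of_real (snd p) powr 2 = of_real (snd p)^2"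
      using powr_nat'[of "complex_of_real (snd p)" 2] y by simp
    finally show ?thesis .
  qed
  ultimately show ?thesis
    by (simp add: hodge_star2_hyperbolic)
qed

theorem corollary6p2:
  fixes s :: complex and w :: form1
  assumes "\<And>p v. p \<in> upper_half_plane \<Longrightarrow> w p v = (of_real (snd p) powr s) * dx p v"
  shows "\<forall>p\<in>upper_half_plane. \<forall>v.
           hodge_laplacian1 hyperbolic_metric w p v = - s * (s + 1) * w p v"
proof (intro ballI allI)
  fix p v assume p: "p \<in> upper_half_plane"
  \<comment> \<open>Zero is written as a multiple of a power of \<open>y\<close>, so that the derivative rule for such powers applies.\<close>
  have codiff: "codiff1 hyperbolic_metric w q = 0 * of_real (snd q) powr 0"
    if "q \<in> upper_half_plane" for q
    using codiff1_height_powr_dx[OF assms that] by simp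
  have d_delta: "ext_d0 (codiff1 hyperbolic_metric w) p v = 0"
    by (simp add: ext_d0_def frechet_derivative_height_powr[OF codiff p])
  have "ext_d0 (hodge_star2 hyperbolic_metric (ext_d1 w)) p u =
          - s * ((s + 1) * of_real (snd p) powr s) * of_real (snd u)" for u
    using frechet_derivative_height_powr[OF hodge_star2_ext_d1_height_powr_dx[OF assms] p]
    by (simp add: ext_d0_def)
  then have delta_d: "codiff2 hyperbolic_metric (ext_d1 w) p v =
          - s * (s + 1) * of_real (snd p) powr s * of_real (fst v)"
    by (simp add: codiff2_def hodge_star1_hyperbolic[OF p])
  show "hodge_laplacian1 hyperbolic_metric w p v = - s * (s + 1) * w p v"
    by (simp add: hodge_laplacian1_def d_delta delta_d assms[OF p] dx_def)
qed

end
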